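(* Let $\phi$ and $E$ be entire functions such that $\phi(\mathbb{C}_+)\subseteq\mathbb{C}_+$, $\phi^{\#}=\phi$ on $\mathbb{C}_+$, and $E$ belongs to the Hermite-Biehler class $\mathcal{H}B$. If the following two conditions are satisfied: (1) $\dfrac{E\circ\phi}{E}\in H^\infty(\mathbb{C}_+)$, (2) $\displaystyle\sup_{z\in\mathbb{C}_+}\frac{\Im(z)}{\Im(\phi(z))}<\infty$, then the composition operator $C_\phi$, $C_\phi f=f\circ\phi$, is bounded on $H(E)$.
   Context: $\mathbb{C}_+$ is the open upper half-plane; for an entire function $f$, $f^{\#}(z):=\overline{f(\bar z)}$. $H^\infty(\mathbb{C}_+)$ is the set of bounded analytic functions on $\mathbb{C}_+$ and $H^2(\mathbb{C}_+)$ is the Hardy Hilbert space on $\mathbb{C}_+$. An entire function $E$ is in the Hermite-Biehler class $\mathcal{H}B$ if $|E(\bar z)|<|E(z)|$ for all $z\in\mathbb{C}_+$. For $E\in\mathcal{H}B$ the de Branges space is $$H(E):=\left\{f \text{ entire}: \tfrac{f}{E},\ \tfrac{f^{\#}}{E}\in H^2(\mathbb{C}_+)\right\},\qquad \langle f,g\rangle_{H(E)}=\int_{-\infty}^{\infty}\frac{f(t)\overline{g(t)}}{|E(t)|^2}\,dt .$$ Saying that $C_\phi$ is bounded on $H(E)$ means that $f\circ\phi\in H(E)$ for every $f\in H(E)$ and $f\mapsto f\circ\phi$ is a bounded linear operator on $H(E)$. *)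

theory Defs
  imports "HOL-Complex_Analysis.Complex_Analysis"
begin

definition upper_half_plane :: "complex set" where
  "upper_half_plane = {z. Im z > 0}"

definition sharp :: "(complex \<Rightarrow> complex) \<Rightarrow> complex \<Rightarrow> complex" where
  "sharp f = (\<lambda>z. cnj (f (cnj z)))"

text \<open>
  Membership in \<open>hardy_inf\<close>, \<open>hardy_2\<close> depends only on the values on the upper half-plane;
  elements are total functions whose values elsewhere are irrelevant.
\<close>

definition hardy_inf :: "(complex \<Rightarrow> complex) set" where
  "hardy_inf = {f. f holomorphic_on upper_half_plane \<and> bounded (f ` upper_half_plane)}"

definition hardy_2 :: "(complex \<Rightarrow> complex) set" where
  "hardy_2 = {f. f holomorphic_on upper_half_plane \<and>
     (SUP y\<in>{0<..}. \<integral>\<^sup>+x. ennreal ((cmod (f (Complex x y)))\<^sup>2) \<partial>lborel) < \<infinity>}"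

definition hermite_biehler :: "(complex \<Rightarrow> complex) set" where
  "hermite_biehler = {E. E holomorphic_on UNIV \<and>
     (\<forall>z\<in>upper_half_plane. cmod (E (cnj z)) < cmod (E z))}"

definition de_branges_space :: "(complex \<Rightarrow> complex) \<Rightarrow> (complex \<Rightarrow> complex) set" where
  "de_branges_space E = {f. f holomorphic_on UNIV \<and>
     (\<lambda>z. f z / E z) \<in> hardy_2 \<and> (\<lambda>z. sharp f z / E z) \<in> hardy_2}"

text \<open>
  \<open>E\<close> may have real zeros. They form a countable set, so the value 0 that division gives to
  the integrand there does not affect the integral.
\<close>

definition de_branges_inner ::
  "(complex \<Rightarrow> complex) \<Rightarrow> (complex \<Rightarrow> complex) \<Rightarrow> (complex \<Rightarrow> complex) \<Rightarrow> complex" where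
  "de_branges_inner E f g =
     (LINT t|lborel. f (of_real t) * cnj (g (of_real t)) / of_real ((cmod (E (of_real t)))\<^sup>2))"

definition de_branges_norm :: "(complex \<Rightarrow> complex) \<Rightarrow> (complex \<Rightarrow> complex) \<Rightarrow> real" where
  "de_branges_norm E f = sqrt (Re (de_branges_inner E f f))"

definition bounded_operator_on_de_branges ::
  "(complex \<Rightarrow> complex) \<Rightarrow> ((complex \<Rightarrow> complex) \<Rightarrow> (complex \<Rightarrow> complex)) \<Rightarrow> bool" where
  "bounded_operator_on_de_branges E T \<longleftrightarrow>
     (\<forall>f\<in>de_branges_space E. T f \<in> de_branges_space E) \<and>
     (\<forall>f\<in>de_branges_space E. \<forall>g\<in>de_branges_space E. T (\<lambda>z. f z + g z) = (\<lambda>z. T f z + T g z)) \<and>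
     (\<forall>c. \<forall>f\<in>de_branges_space E. T (\<lambda>z. c * f z) = (\<lambda>z. c * T f z)) \<and>
     (\<exists>K. \<forall>f\<in>de_branges_space E. de_branges_norm E (T f) \<le> K * de_branges_norm E f)"

definition composition_operator ::
  "(complex \<Rightarrow> complex) \<Rightarrow> (complex \<Rightarrow> complex) \<Rightarrow> complex \<Rightarrow> complex" where
  "composition_operator \<phi> f = f \<circ> \<phi>"

end

theory Submission
  imports Defs
begin

text \<open>
  The key is that \<open>\<phi>\<close> is affine,
  \<open>\<phi> z = b + c z\<close> with real \<open>b\<close> and \<open>c > 0\<close>. Indeed, \<open>\<phi>\<close> preserves the open upper half-plane,
  the open lower half-plane and the real line, and its derivative is nonnegative on the real line,
  so the entire function \<open>(\<phi> z - \<phi> 0) / z\<close> omits every negative real number. By Picard's little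
  theorem it is constant (\<open>entire_half_plane_self_map_affine\<close>).

  For an affine symbol everything is a change of variables. Write
  \<open>f (\<phi> z) / E z = (E (\<phi> z) / E z) * (f / E) (\<phi> z)\<close>. The first factor is bounded by some \<open>M\<close>,
  and precomposition with \<open>z \<mapsto> b + c z\<close> permutes the horizontal lines in the upper half-plane
  and multiplies each integral by \<open>1 / c\<close>; so \<open>f / E\<close> in \<open>H\<^sup>2\<close> gives \<open>(f \<circ> \<phi>) / E\<close> in \<open>H\<^sup>2\<close>
  (\<open>hardy_2_mult_hardy_inf\<close>, \<open>hardy_2_compose_affine\<close>). Since \<open>\<phi>\<close> commutes with conjugation,
  the same argument applies to \<open>sharp f\<close>, which shows that the de Branges space is invariant.

  The bound \<open>M\<close> persists on the real line by continuity, and the same substitution there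
  gives \<open>\<parallel>f \<circ> \<phi>\<parallel> \<le> (M / sqrt c) \<parallel>f\<parallel>\<close>. Because a Bochner integral of a nonintegrable function is \<open>0\<close>,
  this comparison needs \<open>\<bar>f / E\<bar>\<^sup>2\<close> to be integrable on the real line; this follows from
  Fatou's lemma (\<open>hardy_2_boundary_nn_integral_finite\<close>).
\<close>

section \<open>Entire functions preserving the half-plane and the real line\<close>

text \<open>
  By the Cauchy-Riemann equations \<open>Re d\<close> is the derivative of \<open>Im \<phi>\<close> along the upward vertical line
  through \<open>x\<close>, and along that line \<open>Im \<phi>\<close> starts at \<open>0\<close> and is positive afterwards.
\<close>

lemma real_axis_derivative_nonneg:
  fixes \<phi> :: "complex \<Rightarrow> complex" and x :: real
  assumes diff: "(\<phi> has_field_derivative d) (at (of_real x))"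
    and real: "Im (\<phi> (of_real x)) = 0"
    and upper: "\<And>z. 0 < Im z \<Longrightarrow> 0 < Im (\<phi> z)"
  shows "0 \<le> Re d"
proof (rule ccontr)
  assume neg: "\<not> 0 \<le> Re d"
  have "((\<lambda>y::real. of_real x + \<i> * of_real y) has_vector_derivative \<i>) (at 0)"
    by (auto intro!: derivative_eq_intros simp: has_vector_derivative_def)
       (auto simp: scaleR_conv_of_real algebra_simps)
  then have "(\<phi> \<circ> (\<lambda>y::real. of_real x + \<i> * of_real y) has_vector_derivative \<i> * d) (at 0)"
    using diff by (intro field_vector_diff_chain_at) auto
  then have "((\<lambda>y::real. Im (\<phi> (of_real x + \<i> * of_real y))) has_real_derivative Re d) (at 0)"
    by (simp add: has_vector_derivative_complex_iff o_def)
  from has_real_derivative_neg_dec_right[OF this] neg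
  obtain e where "e > 0" and e: "\<And>h. \<lbrakk>0 < h; h < e\<rbrakk> \<Longrightarrow>
      Im (\<phi> (of_real x + \<i> * of_real h)) < Im (\<phi> (of_real x))"
    by (auto simp: not_le)
  have "0 < Im (\<phi> (of_real x + \<i> * of_real (e/2)))"
    using \<open>e > 0\<close> by (intro upper) simp
  with e[of "e/2"] \<open>e > 0\<close> real show False by simp
qed

text \<open>
  Suppose that the difference quotient \<open>(\<phi> z - \<phi> 0) / z\<close> equals \<open>- k\<close> with \<open>k > 0\<close>. Then
  \<open>Im (\<phi> z) = - k Im z\<close>, which is impossible off the real line because \<open>\<phi>\<close> preserves the sign of
  the imaginary part. On the real line it is impossible because \<open>\<phi>\<close> is nondecreasing there,
  and at \<open>z = 0\<close> because \<open>\<phi>'(0) \<ge> 0\<close>. In particular the quotient omits \<open>-1\<close> and \<open>-2\<close>, so Picard's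
  little theorem makes it constant.
\<close>
lemma entire_half_plane_self_map_affine:
  fixes \<phi> :: "complex \<Rightarrow> complex"
  assumes hol: "\<phi> holomorphic_on UNIV"
    and upper: "\<And>z. 0 < Im z \<Longrightarrow> 0 < Im (\<phi> z)"
    and sym: "\<And>z. \<phi> (cnj z) = cnj (\<phi> z)"
  obtains b c :: real where "c > 0" and "\<And>z. \<phi> z = of_real b + of_real c * z"
proof -
  define h where "h = (\<lambda>z. if z = 0 then deriv \<phi> 0 else (\<phi> z - \<phi> 0) / (z - 0))"
  have "h holomorphic_on UNIV"
    unfolding h_def by (rule pole_lemma) (use hol in auto)
  have real: "Im (\<phi> (of_real x)) = 0" for x :: real
    using sym[of "of_real x"] by (simp add: complex_eq_iff)
  have lower: "Im (\<phi> z) < 0" if "Im z < 0" for z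
    using upper[of "cnj z"] sym[of z] that by simp
  have der: "(\<phi> has_field_derivative deriv \<phi> z) (at z)" for z
    using hol by (simp add: holomorphic_derivI)
  have deriv_nonneg: "0 \<le> Re (deriv \<phi> (of_real x))" for x :: real
    using real_axis_derivative_nonneg[OF der real upper] .
  have "((\<lambda>x. Re (\<phi> (of_real x))) has_real_derivative Re (deriv \<phi> (of_real x))) (at x)"
    for x :: real
    using has_vector_derivative_real_field[OF der] by (rule has_field_derivative_Re)
  then have mono: "Re (\<phi> (of_real x)) \<le> Re (\<phi> (of_real y))" if "x \<le> y" for x y :: real
    using that deriv_nonneg DERIV_nonneg_imp_nondecreasing[of x y "\<lambda>x. Re (\<phi> (of_real x))"]
    by blast
  have omits: "h z \<noteq> - of_real k" if "k > 0" for z and k :: real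
  proof
    assume hz: "h z = - of_real k"
    have "z \<noteq> 0"
      using hz deriv_nonneg[of 0] \<open>k > 0\<close> by (auto simp: h_def)
    then have eq: "\<phi> z = \<phi> 0 - of_real k * z"
      using hz by (auto simp: h_def field_simps)
    then have "Im (\<phi> z) = - k * Im z"
      using real[of 0] by simp
    have "Im z = 0"
    proof (rule ccontr)
      assume "Im z \<noteq> 0"
      then consider "Im z > 0" | "Im z < 0" by linarith
      then show False
      proof cases
        case 1
        then have "k * Im z > 0" using \<open>k > 0\<close> by simp
        with upper[OF 1] \<open>Im (\<phi> z) = - k * Im z\<close> show False by simp
      next
        case 2
        then have "k * Im z < 0" using \<open>k > 0\<close> by (simp add: mult_pos_neg)
        with lower[OF 2] \<open>Im (\<phi> z) = - k * Im z\<close> show False by simp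
      qed
    qed
    then obtain x where x: "z = of_real x"
      by (metis complex_is_Real_iff Reals_cases)
    then have "Re (\<phi> (of_real x)) = Re (\<phi> (of_real 0)) - k * x" and "x \<noteq> 0"
      using eq \<open>z \<noteq> 0\<close> by auto
    moreover have "k * x > 0" if "x > 0" using that \<open>k > 0\<close> by simp
    moreover have "k * x < 0" if "x < 0" using that \<open>k > 0\<close> by (simp add: mult_pos_neg)
    ultimately show False
      using mono[of 0 x] mono[of x 0] by (cases "x > 0") auto
  qed
  obtain c where c: "h = (\<lambda>_. c)"
  proof (rule little_Picard[OF \<open>h holomorphic_on UNIV\<close>, of "-1" "-2"])
    show "range h \<inter> {-1, -2} = {}"
      using omits[of 1] omits[of 2] by (auto simp: image_iff)
        (metis of_real_1 of_real_numeral zero_less_numeral zero_less_one)+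
  qed auto
  have form: "\<phi> z = \<phi> 0 + c * z" for z
    using fun_cong[OF c, of z] by (cases "z = 0") (auto simp: h_def field_simps)
  have "Im c = 0"
    using form[of 1] real[of 1] real[of 0] by simp
  moreover have "Re c > 0"
    using form[of \<i>] upper[of \<i>] real[of 0] by simp
  ultimately have "\<phi> z = of_real (Re (\<phi> 0)) + of_real (Re c) * z" for z
    using form[of z] real[of 0] by (simp add: complex_eq_iff)
  with \<open>Re c > 0\<close> show thesis by (rule that)
qed

text \<open>
  Conjugating the hypothesis gives the identity on the lower half-plane; the real line is
  reached by continuity.
\<close>
lemma entire_symmetric_if_symmetric_on_upper_half_plane:
  assumes hol: "\<phi> holomorphic_on UNIV"
    and sym: "\<forall>z\<in>upper_half_plane. sharp \<phi> z = \<phi> z"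
  shows "\<phi> (cnj z) = cnj (\<phi> z)"
proof -
  have upper: "\<phi> (cnj w) = cnj (\<phi> w)" if "Im w > 0" for w
  proof -
    have "cnj (\<phi> (cnj w)) = \<phi> w"
      using sym that by (simp add: sharp_def upper_half_plane_def)
    from arg_cong[OF this, of cnj] show ?thesis by simp
  qed
  have cont: "isCont \<phi> w" for w
    using hol by (auto simp: continuous_on_eq_continuous_at dest!: holomorphic_on_imp_continuous_on)
  consider "Im z > 0" | "Im z < 0" | "Im z = 0" by linarith
  then show ?thesis
  proof cases
    case 1
    then show ?thesis by (rule upper)
  next
    case 2
    then show ?thesis using upper[of "cnj z"] by simp
  next
    case 3
    have lim1: "((\<lambda>y. \<phi> (cnj (z + \<i> * of_real y))) \<longlongrightarrow> \<phi> (cnj (z + \<i> * of_real 0))) (at_right 0)"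
      by (intro isCont_tendsto_compose[OF cont] tendsto_intros)
    have lim2: "((\<lambda>y. cnj (\<phi> (z + \<i> * of_real y))) \<longlongrightarrow> cnj (\<phi> (z + \<i> * of_real 0))) (at_right 0)"
      by (intro tendsto_intros isCont_tendsto_compose[OF cont])
    have ev: "\<forall>\<^sub>F y in at_right (0::real).
        \<phi> (cnj (z + \<i> * of_real y)) = cnj (\<phi> (z + \<i> * of_real y))"
      using eventually_at_right_less[of "0::real"]
      by eventually_elim (use 3 in \<open>auto intro!: upper simp del: complex_cnj_add\<close>)
    have "\<phi> (cnj (z + \<i> * of_real 0)) = cnj (\<phi> (z + \<i> * of_real 0))"
      using tendsto_unique[OF trivial_limit_at_right_real _ lim2] lim1 tendsto_cong[OF ev] by blast
    then show ?thesis by simp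
  qed
qed

section \<open>Hardy space estimates\<close>

lemma hardy_2I:
  assumes "f holomorphic_on upper_half_plane" and "B < \<infinity>"
    and "\<And>y. 0 < y \<Longrightarrow> (\<integral>\<^sup>+x. ennreal ((cmod (f (Complex x y)))\<^sup>2) \<partial>lborel) \<le> B"
  shows "f \<in> hardy_2"
proof -
  have "(SUP y\<in>{0<..}. \<integral>\<^sup>+x. ennreal ((cmod (f (Complex x y)))\<^sup>2) \<partial>lborel) \<le> B"
    using assms(3) by (intro SUP_least) auto
  then show ?thesis
    using assms(1,2) unfolding hardy_2_def by (auto intro: le_less_trans)
qed

lemma hardy_2E:
  assumes "f \<in> hardy_2"
  obtains B where "f holomorphic_on upper_half_plane" and "B < \<infinity>"
    and "\<And>y. 0 < y \<Longrightarrow> (\<integral>\<^sup>+x. ennreal ((cmod (f (Complex x y)))\<^sup>2) \<partial>lborel) \<le> B"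
  using assms unfolding hardy_2_def by (auto intro: that SUP_upper)

lemma hardy_2_cong:
  assumes "\<And>z. z \<in> upper_half_plane \<Longrightarrow> f z = g z"
  shows "f \<in> hardy_2 \<longleftrightarrow> g \<in> hardy_2"
proof -
  have "f (Complex x y) = g (Complex x y)" if "y > 0" for x y
    using that assms by (simp add: upper_half_plane_def)
  then have "(SUP y\<in>{0<..}. \<integral>\<^sup>+x. ennreal ((cmod (f (Complex x y)))\<^sup>2) \<partial>lborel) =
      (SUP y\<in>{0<..}. \<integral>\<^sup>+x. ennreal ((cmod (g (Complex x y)))\<^sup>2) \<partial>lborel)"
    by (intro SUP_cong refl) auto
  then show ?thesis
    unfolding hardy_2_def using holomorphic_cong[OF refl assms] by auto
qed

lemma borel_measurable_cmod_horizontal_line: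
  assumes "f holomorphic_on upper_half_plane" and "y > 0"
  shows "(\<lambda>x. cmod (f (Complex x y))) \<in> borel_measurable borel"
proof -
  have "continuous_on upper_half_plane f"
    using assms by (simp add: holomorphic_on_imp_continuous_on)
  then have "continuous_on UNIV (\<lambda>x. f (of_real x + \<i> * of_real y))"
    by (rule continuous_on_compose2)
       (use \<open>y > 0\<close> in \<open>auto intro!: continuous_intros simp: upper_half_plane_def\<close>)
  then show ?thesis
    by (intro borel_measurable_continuous_onI continuous_on_norm) (simp add: Complex_eq)
qed

lemma hardy_2_mult_hardy_inf:
  assumes g: "g \<in> hardy_inf" and f: "f \<in> hardy_2"
  shows "(\<lambda>z. g z * f z) \<in> hardy_2"
proof -
  obtain B where hol: "f holomorphic_on upper_half_plane" and "B < \<infinity>"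
    and B: "\<And>y. 0 < y \<Longrightarrow> (\<integral>\<^sup>+x. ennreal ((cmod (f (Complex x y)))\<^sup>2) \<partial>lborel) \<le> B"
    using f by (rule hardy_2E) (blast intro: that)
  obtain M where "M > 0" and M: "\<And>z. z \<in> upper_half_plane \<Longrightarrow> cmod (g z) \<le> M"
    using g unfolding hardy_inf_def bounded_pos by auto
  show ?thesis
  proof (rule hardy_2I[where B = "ennreal (M\<^sup>2) * B"])
    show "(\<lambda>z. g z * f z) holomorphic_on upper_half_plane"
      using g hol by (auto simp: hardy_inf_def intro!: holomorphic_intros)
    show "ennreal (M\<^sup>2) * B < \<infinity>"
      using \<open>B < \<infinity>\<close> by (simp add: ennreal_mult_less_top)
    fix y :: real assume "y > 0"
    note [measurable] = borel_measurable_cmod_horizontal_line[OF hol \<open>y > 0\<close>]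
    have "(\<integral>\<^sup>+x. ennreal ((cmod (g (Complex x y) * f (Complex x y)))\<^sup>2) \<partial>lborel)
        \<le> (\<integral>\<^sup>+x. ennreal (M\<^sup>2) * ennreal ((cmod (f (Complex x y)))\<^sup>2) \<partial>lborel)"
      using M \<open>y > 0\<close>
      by (intro nn_integral_mono)
         (auto simp: ennreal_mult[symmetric] norm_mult power_mult_distrib upper_half_plane_def
               intro!: mult_right_mono power_mono)
    also have "\<dots> = ennreal (M\<^sup>2) * (\<integral>\<^sup>+x. ennreal ((cmod (f (Complex x y)))\<^sup>2) \<partial>lborel)"
      by (rule nn_integral_cmult) measurable
    also have "\<dots> \<le> ennreal (M\<^sup>2) * B"
      by (intro mult_left_mono B \<open>y > 0\<close>) simp
    finally show "(\<integral>\<^sup>+x. ennreal ((cmod (g (Complex x y) * f (Complex x y)))\<^sup>2) \<partial>lborel)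
        \<le> ennreal (M\<^sup>2) * B" .
  qed
qed

text \<open>
  The line at height \<open>y\<close> is carried to the line at height \<open>c y\<close>, with its length scaled by \<open>c\<close>.
\<close>
lemma hardy_2_compose_affine:
  fixes b c :: real
  assumes f: "f \<in> hardy_2" and "c > 0"
  shows "(\<lambda>z. f (of_real b + of_real c * z)) \<in> hardy_2"
proof -
  obtain B where hol: "f holomorphic_on upper_half_plane" and "B < \<infinity>"
    and B: "\<And>y. 0 < y \<Longrightarrow> (\<integral>\<^sup>+x. ennreal ((cmod (f (Complex x y)))\<^sup>2) \<partial>lborel) \<le> B"
    using f by (rule hardy_2E) (blast intro: that)
  show ?thesis
  proof (rule hardy_2I[where B = "ennreal (1 / c) * B"])
    have "f \<circ> (\<lambda>z. of_real b + of_real c * z) holomorphic_on upper_half_plane"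
      using hol \<open>c > 0\<close>
      by (intro holomorphic_on_compose_gen[where t = upper_half_plane])
         (auto simp: upper_half_plane_def intro!: holomorphic_intros)
    then show "(\<lambda>z. f (of_real b + of_real c * z)) holomorphic_on upper_half_plane"
      by (simp add: o_def)
    show "ennreal (1 / c) * B < \<infinity>"
      using \<open>B < \<infinity>\<close> by (simp add: ennreal_mult_less_top)
    fix y :: real assume "y > 0"
    let ?I = "\<integral>\<^sup>+x. ennreal ((cmod (f (Complex (b + c * x) (c * y))))\<^sup>2) \<partial>lborel"
    have "c * y > 0" using \<open>c > 0\<close> \<open>y > 0\<close> by simp
    note [measurable] = borel_measurable_cmod_horizontal_line[OF hol this]
    have "ennreal c * ?I = (\<integral>\<^sup>+x. ennreal ((cmod (f (Complex x (c * y))))\<^sup>2) \<partial>lborel)"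
      using \<open>c > 0\<close> by (subst nn_integral_real_affine[where c = c and t = b]) auto
    also have "\<dots> \<le> B" by (rule B) fact
    finally have "ennreal (1 / c) * (ennreal c * ?I) \<le> ennreal (1 / c) * B"
      by (rule mult_left_mono) simp
    moreover have "ennreal (1 / c) * (ennreal c * ?I) = ?I"
      using \<open>c > 0\<close> by (simp add: mult.assoc[symmetric] ennreal_mult[symmetric])
    moreover have "of_real b + of_real c * Complex x y = Complex (b + c * x) (c * y)" for x
      by (simp add: complex_eq_iff)
    ultimately show "(\<integral>\<^sup>+x. ennreal ((cmod (f (of_real b + of_real c * Complex x y)))\<^sup>2) \<partial>lborel)
        \<le> ennreal (1 / c) * B"
      by simp
  qed
qed

text \<open>
  Fatou's lemma along a sequence of horizontal lines descending to the real axis. Almost everywhere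
  continuity replaces the general theory of boundary values, and suffices for quotients of entire
  functions.
\<close>
lemma hardy_2_boundary_nn_integral_finite:
  assumes f: "f \<in> hardy_2" and cont: "AE t in lborel. isCont f (of_real t)"
  shows "(\<integral>\<^sup>+t. ennreal ((cmod (f (of_real t)))\<^sup>2) \<partial>lborel) < \<infinity>"
proof -
  obtain B where hol: "f holomorphic_on upper_half_plane" and "B < \<infinity>"
    and B: "\<And>y. 0 < y \<Longrightarrow> (\<integral>\<^sup>+x. ennreal ((cmod (f (Complex x y)))\<^sup>2) \<partial>lborel) \<le> B"
    using f by (rule hardy_2E) (blast intro: that)
  define y :: "nat \<Rightarrow> real" where "y n = inverse (real (Suc n))" for n
  have y_pos: "y n > 0" for n by (simp add: y_def)
  have y_lim: "y \<longlonglongrightarrow> 0" unfolding y_def by (rule LIMSEQ_inverse_real_of_nat)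
  note [measurable] = borel_measurable_cmod_horizontal_line[OF hol y_pos]
  have "AE t in lborel. ennreal ((cmod (f (of_real t)))\<^sup>2)
      \<le> liminf (\<lambda>n. ennreal ((cmod (f (Complex t (y n))))\<^sup>2))"
    using cont
  proof eventually_elim
    case (elim t)
    have "(\<lambda>n. of_real t + \<i> * of_real (y n)) \<longlonglongrightarrow> of_real t + \<i> * of_real 0"
      by (intro tendsto_intros y_lim)
    then have "(\<lambda>n. Complex t (y n)) \<longlonglongrightarrow> of_real t"
      by (simp add: Complex_eq)
    then have "(\<lambda>n. ennreal ((cmod (f (Complex t (y n))))\<^sup>2)) \<longlonglongrightarrow> ennreal ((cmod (f (of_real t)))\<^sup>2)"
      by (intro tendsto_intros isCont_tendsto_compose[OF elim])
    from lim_imp_Liminf[OF _ this] show ?case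
      by simp
  qed
  then have "(\<integral>\<^sup>+t. ennreal ((cmod (f (of_real t)))\<^sup>2) \<partial>lborel)
      \<le> (\<integral>\<^sup>+t. liminf (\<lambda>n. ennreal ((cmod (f (Complex t (y n))))\<^sup>2)) \<partial>lborel)"
    by (rule nn_integral_mono_AE)
  also have "\<dots> \<le> liminf (\<lambda>n. \<integral>\<^sup>+t. ennreal ((cmod (f (Complex t (y n))))\<^sup>2) \<partial>lborel)"
    by (rule nn_integral_liminf) measurable
  also have "\<dots> \<le> B"
    using B y_pos by (intro Liminf_le) auto
  finally show ?thesis using \<open>B < \<infinity>\<close> by simp
qed

section \<open>Boundary values and the norm of a de Branges space\<close>

lemma entire_AE_real_nonzero:
  assumes "g holomorphic_on UNIV" and "g w \<noteq> 0"
  shows "AE t in lborel. g (of_real t) \<noteq> 0"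
proof (cases "g constant_on UNIV")
  case True
  then show ?thesis using assms(2) by (metis (mono_tags, lifting) AE_I2 UNIV_I constant_on_def)
next
  case False
  then have "countable {z \<in> UNIV. g z = 0}"
    using assms by (intro holomorphic_countable_zeros) auto
  then have "countable (complex_of_real -` {z. g z = 0})"
    by (intro countable_image_inj_eq[THEN iffD1, of complex_of_real, OF inj_on_subset[OF inj_of_real]])
       (auto elim: countable_subset[rotated])
  then have "complex_of_real -` {z. g z = 0} \<in> null_sets lborel"
    by (rule countable_imp_null_set_lborel)
  from AE_not_in[OF this] show ?thesis by simp
qed

lemma de_branges_norm_eq:
  "de_branges_norm E f = sqrt (LINT t|lborel. (cmod (f (of_real t) / E (of_real t)))\<^sup>2)"
proof -
  have "f (of_real t) * cnj (f (of_real t)) / of_real ((cmod (E (of_real t)))\<^sup>2) =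
      complex_of_real ((cmod (f (of_real t) / E (of_real t)))\<^sup>2)" for t :: real
    by (simp add: complex_norm_square[symmetric] norm_divide power_divide)
  then show ?thesis
    unfolding de_branges_norm_def de_branges_inner_def
    by (simp only: integral_complex_of_real Re_complex_of_real)
qed

lemma de_branges_boundary_integrable:
  assumes f: "f \<in> de_branges_space E" and E: "E holomorphic_on UNIV" and "E w \<noteq> 0"
  shows "integrable lborel (\<lambda>t. (cmod (f (of_real t) / E (of_real t)))\<^sup>2)"
proof -
  have f_hol: "f holomorphic_on UNIV" and "(\<lambda>z. f z / E z) \<in> hardy_2"
    using f by (auto simp: de_branges_space_def)
  have cont: "isCont f z" "isCont E z" for z
    using f_hol E by (auto simp: continuous_on_eq_continuous_at dest!: holomorphic_on_imp_continuous_on)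
  have "AE t in lborel. isCont (\<lambda>z. f z / E z) (of_real t)"
    using entire_AE_real_nonzero[OF E \<open>E w \<noteq> 0\<close>]
    by eventually_elim (intro continuous_intros cont)
  then have "(\<integral>\<^sup>+t. ennreal ((cmod (f (of_real t) / E (of_real t)))\<^sup>2) \<partial>lborel) < \<infinity>"
    using hardy_2_boundary_nn_integral_finite[OF \<open>(\<lambda>z. f z / E z) \<in> hardy_2\<close>] by simp
  moreover have [measurable]: "f \<in> borel_measurable borel" "E \<in> borel_measurable borel"
    using f_hol E by (auto intro!: borel_measurable_continuous_onI holomorphic_on_imp_continuous_on)
  ultimately show ?thesis
    by (intro integrableI_nonneg) auto
qed

text \<open>
  Clearing the denominator before letting \<open>Im z\<close> tend to \<open>0\<close> makes the bound valid at real zeros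
  of \<open>E\<close> as well.
\<close>
lemma quotient_bound_extends_to_real_axis:
  assumes hol: "g holomorphic_on UNIV" "E holomorphic_on UNIV"
    and "\<And>z. z \<in> upper_half_plane \<Longrightarrow> E z \<noteq> 0"
    and "\<And>z. z \<in> upper_half_plane \<Longrightarrow> cmod (g z / E z) \<le> M"
  shows "cmod (g (of_real t)) \<le> M * cmod (E (of_real t))"
proof -
  have cont: "isCont g z" "isCont E z" for z
    using hol by (auto simp: continuous_on_eq_continuous_at dest!: holomorphic_on_imp_continuous_on)
  have lim1: "((\<lambda>y. cmod (g (of_real t + \<i> * of_real y))) \<longlongrightarrow> cmod (g (of_real t + \<i> * of_real 0)))
      (at_right 0)"
    by (intro tendsto_intros isCont_tendsto_compose[OF cont(1)])
  have lim2: "((\<lambda>y. M * cmod (E (of_real t + \<i> * of_real y))) \<longlongrightarrow>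
      M * cmod (E (of_real t + \<i> * of_real 0))) (at_right 0)"
    by (intro tendsto_intros isCont_tendsto_compose[OF cont(2)])
  have ev: "\<forall>\<^sub>F y in at_right (0::real). cmod (g (of_real t + \<i> * of_real y)) \<le>
      M * cmod (E (of_real t + \<i> * of_real y))"
    using eventually_at_right_less[of "0::real"]
  proof eventually_elim
    case (elim y)
    then have upper: "of_real t + \<i> * of_real y \<in> upper_half_plane"
      by (simp add: upper_half_plane_def)
    show ?case
      using assms(3)[OF upper] assms(4)[OF upper]
      by (simp add: norm_divide pos_divide_le_eq)
  qed
  have "cmod (g (of_real t + \<i> * of_real 0)) \<le> M * cmod (E (of_real t + \<i> * of_real 0))"
    by (rule tendsto_le[OF trivial_limit_at_right_real lim2 lim1 ev])
  then show ?thesis by simp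
qed

section \<open>Boundedness of the composition operator\<close>

theorem theorem4p1:
  fixes \<phi> E :: "complex \<Rightarrow> complex"
  assumes "\<phi> holomorphic_on UNIV"
    and "E holomorphic_on UNIV"
    and "\<phi> ` upper_half_plane \<subseteq> upper_half_plane"
    and "\<forall>z\<in>upper_half_plane. sharp \<phi> z = \<phi> z"
    and "E \<in> hermite_biehler"
    and "(\<lambda>z. (E \<circ> \<phi>) z / E z) \<in> hardy_inf"
    and "bdd_above ((\<lambda>z. Im z / Im (\<phi> z)) ` upper_half_plane)"
  shows "bounded_operator_on_de_branges E (composition_operator \<phi>)"
proof -
  have sym: "\<phi> (cnj z) = cnj (\<phi> z)" for z
    using entire_symmetric_if_symmetric_on_upper_half_plane[OF assms(1,4)] .
  have "0 < Im (\<phi> z)" if "0 < Im z" for z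
    using assms(3) that by (auto simp: upper_half_plane_def)
  from entire_half_plane_self_map_affine[OF assms(1) this sym]
  obtain b c :: real where "c > 0" and \<phi>: "\<And>z. \<phi> z = of_real b + of_real c * z"
    by blast
  have \<phi>_upper: "\<phi> z \<in> upper_half_plane" if "z \<in> upper_half_plane" for z
    using assms(3) that by auto
  have E_nz: "E z \<noteq> 0" if "z \<in> upper_half_plane" for z
    using assms(5) that by (force simp: hermite_biehler_def)
  have i_upper: "\<i> \<in> upper_half_plane" by (simp add: upper_half_plane_def)
  have quotient_hardy: "(\<lambda>z. g (\<phi> z) / E z) \<in> hardy_2" if "(\<lambda>z. g z / E z) \<in> hardy_2" for g
  proof -
    have "(\<lambda>z. (E \<circ> \<phi>) z / E z * (g (of_real b + of_real c * z) / E (of_real b + of_real c * z)))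
        \<in> hardy_2"
      by (intro hardy_2_mult_hardy_inf assms(6) hardy_2_compose_affine[OF that \<open>c > 0\<close>])
    then show ?thesis
      using E_nz \<phi>_upper
      by (subst hardy_2_cong[where g = "\<lambda>z. (E \<circ> \<phi>) z / E z *
          (g (of_real b + of_real c * z) / E (of_real b + of_real c * z))"])
         (auto simp: \<phi>[symmetric])
  qed
  have invariant: "f \<circ> \<phi> \<in> de_branges_space E" if "f \<in> de_branges_space E" for f
  proof -
    have "sharp (f \<circ> \<phi>) z = sharp f (\<phi> z)" for z
      by (simp add: sharp_def sym)
    moreover have "f \<circ> \<phi> holomorphic_on UNIV"
      using that assms(1)
      by (auto simp: de_branges_space_def intro: holomorphic_on_compose_gen)
    ultimately show ?thesis
      using that quotient_hardy[of f] quotient_hardy[of "sharp f"]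
      by (simp add: de_branges_space_def)
  qed
  obtain M where M: "\<And>z. z \<in> upper_half_plane \<Longrightarrow> cmod ((E \<circ> \<phi>) z / E z) \<le> M"
    using assms(6) by (auto simp: hardy_inf_def bounded_iff)
  have E\<phi>_hol: "E \<circ> \<phi> holomorphic_on UNIV"
    using assms(1,2) by (auto intro: holomorphic_on_compose_gen)
  have E\<phi>_le: "cmod (E (\<phi> (of_real t))) \<le> M * cmod (E (of_real t))" for t :: real
    using quotient_bound_extends_to_real_axis[OF E\<phi>_hol assms(2) E_nz M] by simp
  have "M \<ge> 0" using M[OF i_upper] norm_ge_zero order_trans by blast
  \<comment> \<open>The factor \<open>sqrt (1 / c)\<close> is the Jacobian of \<open>t \<mapsto> b + c * t\<close> under the square root.\<close>
  have norm_le: "de_branges_norm E (f \<circ> \<phi>) \<le> M * sqrt (1 / c) * de_branges_norm E f"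
    if f: "f \<in> de_branges_space E" for f
  proof -
    define G where "G t = (cmod (f (of_real t) / E (of_real t)))\<^sup>2" for t :: real
    have int: "integrable lborel G"
      unfolding G_def by (rule de_branges_boundary_integrable[OF f assms(2) E_nz[OF i_upper]])
    \<comment> \<open>Division by \<open>0\<close> yields \<open>0\<close>, so the pointwise bound may fail where \<open>E (\<phi> t) = 0\<close>;
      such points form a null set.\<close>
    have "AE t in lborel. (E \<circ> \<phi>) (of_real t) \<noteq> 0"
      using E_nz[OF \<phi>_upper[OF i_upper]] by (intro entire_AE_real_nonzero[OF E\<phi>_hol, of \<i>]) simp
    then have le: "AE t in lborel. (cmod ((f \<circ> \<phi>) (of_real t) / E (of_real t)))\<^sup>2 \<le> M\<^sup>2 * G (b + c * t)"
    proof eventually_elim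
      case (elim t)
      have pos: "cmod (E (\<phi> (of_real t))) > 0" using elim by simp
      then have "cmod (E (of_real t)) > 0"
        using E\<phi>_le[of t] by (cases "E (of_real t) = 0") auto
      then have "cmod (f (\<phi> (of_real t)) / E (of_real t))
          \<le> M * cmod (f (\<phi> (of_real t)) / E (\<phi> (of_real t)))"
        using pos mult_left_mono[OF E\<phi>_le[of t], of "cmod (f (\<phi> (of_real t)))"]
        by (simp add: norm_divide field_simps)
      from power_mono[OF this norm_ge_zero, of 2] show ?case
        by (simp add: G_def \<phi> power_mult_distrib)
    qed
    have "(LINT t|lborel. (cmod ((f \<circ> \<phi>) (of_real t) / E (of_real t)))\<^sup>2)
        \<le> (LINT t|lborel. M\<^sup>2 * G (b + c * t))"
      using le lborel_integrable_real_affine[OF int, of c b] \<open>c > 0\<close>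
      by (intro integral_mono_AE') (auto simp: G_def)
    also have "\<dots> = M\<^sup>2 * (1 / c) * (LINT t|lborel. G t)"
      using \<open>c > 0\<close> by (subst (2) lborel_integral_real_affine[of c _ b]) auto
    finally have "de_branges_norm E (f \<circ> \<phi>) \<le> sqrt (M\<^sup>2 * (1 / c) * (LINT t|lborel. G t))"
      unfolding de_branges_norm_eq by (rule real_sqrt_le_mono)
    also have "\<dots> = M * sqrt (1 / c) * de_branges_norm E f"
      using \<open>M \<ge> 0\<close> unfolding de_branges_norm_eq G_def
      by (simp only: real_sqrt_mult real_sqrt_abs abs_of_nonneg)
    finally show ?thesis .
  qed
  show ?thesis
    unfolding bounded_operator_on_de_branges_def composition_operator_def
    using invariant norm_le by (auto simp: o_def)
qed

end
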